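(* Let $q$ be a prime power and $r\ge 2$ an integer. Let $\gamma\in\mathbb{F}_{q^r}$ be a primitive element and let $M\in\mathbb{F}_q^{r\times r}$ be the companion matrix of the minimal polynomial of $\gamma$ over $\mathbb{F}_q$. In $\mathrm{PG}(2r-1,q)$ define $V_0=\{[x:0] : x\in\mathrm{PG}(r-1,q)\}$, $V_{q^r}=\{[0:y] : y\in\mathrm{PG}(r-1,q)\}$, and $V_i=\{[x:xM^i] : x\in\mathrm{PG}(r-1,q)\}$ for $1\le i\le q^r-1$. Let $i,j$ be integers with $0<i<j<q^r$ and suppose that for every $s>1$ dividing $r$ we have $j-i\not\equiv 0 \bmod \frac{q^s-1}{q-1}$. Then $\mathcal{B}=V_0\cup V_i\cup V_j\cup V_{q^r}$ is a cutting blocking set in $\mathrm{PG}(2r-1,q)$.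
   Context: $\mathrm{PG}(N,q)$ is the projective space $(\mathbb{F}_q^{N+1}\setminus\{0\})/\!\sim$ over $\mathbb{F}_q$, where $\sim$ is proportionality; vectors are row vectors. A primitive element of $\mathbb{F}_{q^r}$ is a generator of its multiplicative group. A set $\mathcal{M}\subseteq\mathrm{PG}(N,q)$ ($N\ge1$) is a cutting blocking set if for every hyperplane $H$ of $\mathrm{PG}(N,q)$ one has $\langle \mathcal{M}\cap H\rangle=H$, where $\langle\cdot\rangle$ denotes the projective span. (The family $\{V_0,\dots,V_{q^r}\}$ is an $(r-1)$-spread of $\mathrm{PG}(2r-1,q)$, i.e. a partition of its points into $(r-1)$-dimensional subspaces.) *)

theory Defs
  imports
    "Jordan_Normal_Form.VS_Connect"
    "Jordan_Normal_Form.Char_Poly"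
    "HOL-Number_Theory.Cong"
    "HOL-Library.Cardinality"
begin

section \<open>Projective geometry over a finite field\<close>

text \<open>
  Throughout, the finite field with q elements is a type \<open>'a :: {field, finite}\<close> with
  \<open>q = CARD('a)\<close>. Its projective space \<open>PG N\<close> is the set of classes of nonzero vectors of
  length \<open>N + 1\<close> modulo proportionality, so a set of points has type \<open>'a vec set set\<close>.
\<close>

definition proj_rel :: "nat \<Rightarrow> ('a :: field vec \<times> 'a vec) set" where
  "proj_rel N = {(v, w). v \<in> carrier_vec (N + 1) - {0\<^sub>v (N + 1)} \<and>
                         w \<in> carrier_vec (N + 1) - {0\<^sub>v (N + 1)} \<and> (\<exists>c. w = c \<cdot>\<^sub>v v)}"

definition PG :: "nat \<Rightarrow> 'a :: field vec set set" where
  "PG N = (carrier_vec (N + 1) - {0\<^sub>v (N + 1)}) // proj_rel N"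

definition proj_pt :: "nat \<Rightarrow> 'a :: field vec \<Rightarrow> 'a vec set" where
  "proj_pt N v = proj_rel N `` {v}"

definition proj_of :: "nat \<Rightarrow> 'a :: field vec set \<Rightarrow> 'a vec set set" where
  "proj_of N W = proj_pt N ` (W - {0\<^sub>v (N + 1)})"

text \<open>
  The zero subspace is admitted in \<open>proj_subspace\<close>, so the empty set is a projective subspace
  and the span of no points is empty.
\<close>

definition proj_subspace :: "nat \<Rightarrow> 'a :: field vec set set \<Rightarrow> bool" where
  "proj_subspace N S \<longleftrightarrow>
     (\<exists>W. VectorSpace.subspace class_ring W (module_vec TYPE('a) (N + 1)) \<and> S = proj_of N W)"

text \<open>A hyperplane has projective dimension \<open>N - 1\<close>, i.e. vector space dimension \<open>N\<close>.\<close>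

definition hyperplane :: "nat \<Rightarrow> 'a :: field vec set set \<Rightarrow> bool" where
  "hyperplane N S \<longleftrightarrow>
     (\<exists>W. VectorSpace.subspace class_ring W (module_vec TYPE('a) (N + 1)) \<and>
          vectorspace.dim class_ring ((module_vec TYPE('a) (N + 1))\<lparr>carrier := W\<rparr>) = N \<and>
          S = proj_of N W)"

definition proj_span :: "nat \<Rightarrow> 'a :: field vec set set \<Rightarrow> 'a vec set set" where
  "proj_span N S = \<Inter> {T. proj_subspace N T \<and> S \<subseteq> T}"

definition cutting_blocking_set :: "nat \<Rightarrow> 'a :: field vec set set \<Rightarrow> bool" where
  "cutting_blocking_set N B \<longleftrightarrow>
     B \<subseteq> PG N \<and> (\<forall>H. hyperplane N H \<longrightarrow> proj_span N (B \<inter> H) = H)"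

section \<open>Primitive elements, minimal polynomials and companion matrices\<close>

definition primitive_element :: "'b :: field \<Rightarrow> bool" where
  "primitive_element g \<longleftrightarrow> range (\<lambda>k :: int. g powi k) = UNIV - {0}"

text \<open>
  The extension field is a second type \<open>'b\<close>, and \<open>h\<close> is the embedding of the base field into it.
\<close>

definition min_poly :: "('a :: field \<Rightarrow> 'b :: field) \<Rightarrow> 'b \<Rightarrow> 'a poly" where
  "min_poly h g = (THE p. monic p \<and> poly (map_poly h p) g = 0 \<and>
     (\<forall>f. f \<noteq> 0 \<and> poly (map_poly h f) g = 0 \<longrightarrow> degree p \<le> degree f))"

text \<open>
  For \<open>p = X^d + c_(d-1) X^(d-1) + ... + c_0\<close>: ones on the subdiagonal, and
  \<open>- c_0, ..., - c_(d-1)\<close> in the last column.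
\<close>

definition companion_mat :: "'a :: field poly \<Rightarrow> 'a mat" where
  "companion_mat p = mat (degree p) (degree p)
     (\<lambda>(i, j). if Suc j = degree p then - coeff p i else if i = Suc j then 1 else 0)"

section \<open>The spread\<close>

definition row_mult :: "'a :: field vec \<Rightarrow> 'a mat \<Rightarrow> 'a vec" where
  "row_mult x A = vec (dim_col A) (\<lambda>j. x \<bullet> col A j)"

text \<open>The sets \<open>V_i\<close>, meant for \<open>0 \<le> i \<le> q^r\<close>.\<close>

definition spread_elem :: "nat \<Rightarrow> 'a :: {field, finite} mat \<Rightarrow> nat \<Rightarrow> 'a vec set set" where
  "spread_elem r M i =
     (if i = 0 then {proj_pt (2 * r - 1) (x @\<^sub>v 0\<^sub>v r) | x. x \<in> carrier_vec r - {0\<^sub>v r}}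
      else if i = CARD('a) ^ r
      then {proj_pt (2 * r - 1) (0\<^sub>v r @\<^sub>v y) | y. y \<in> carrier_vec r - {0\<^sub>v r}}
      else {proj_pt (2 * r - 1) (x @\<^sub>v row_mult x (M ^\<^sub>m i)) | x. x \<in> carrier_vec r - {0\<^sub>v r}})"

end

(*
  A projective hyperplane is the kernel of a form (u, v), and a set of its points spans it iff
  every form vanishing on these points is a multiple of (u, v).  A form (u', v') vanishing on the
  intersections with V_0 and V_(q^r) satisfies u' = a u and v' = b v.  Reading column vectors as
  elements of the field with q^r elements via the basis 1, \<gamma>, ..., \<gamma>^(r-1), the matrix M is
  multiplication by \<gamma>, so V_i and V_j give a u + b \<gamma>^i v = c (u + \<gamma>^i v) and
  a u + b \<gamma>^j v = d (u + \<gamma>^j v).  If a and b differ and u, v are nonzero, dividing shows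
  that \<gamma>^(j-i) lies in the base field, i.e. (q^r - 1)/(q - 1) divides j - i.
*)

theory Submission
  imports Defs
begin

section \<open>Subspaces, linear forms and hyperplanes of coordinate space\<close>

lemma subspace_vec_iff:
  "VectorSpace.subspace class_ring W (module_vec TYPE('a :: field) n) \<longleftrightarrow>
     W \<subseteq> carrier_vec n \<and> 0\<^sub>v n \<in> W \<and> (\<forall>v\<in>W. \<forall>w\<in>W. v + w \<in> W) \<and> (\<forall>c. \<forall>v\<in>W. c \<cdot>\<^sub>v v \<in> W)"
proof -
  interpret vec_space "TYPE('a)" n .
  show ?thesis
    unfolding VectorSpace.subspace_def submodule_def
    using vec_vs module_axioms by (auto simp: module_vec_simps)
qed

lemma card_carrier_vec: "card (carrier_vec n :: 'a :: finite vec set) = CARD('a) ^ n"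
proof -
  have "bij_betw vec_of_list {xs :: 'a list. set xs \<subseteq> UNIV \<and> length xs = n} (carrier_vec n)"
    by (rule bij_betw_byWitness[of _ list_of_vec]) (auto simp: vec_list list_vec intro: carrier_vecI)
  from bij_betw_same_card[OF this] show ?thesis
    unfolding card_lists_length_eq[OF finite] by simp
qed

lemma finite_carrier_vec: "finite (carrier_vec n :: 'a :: finite vec set)"
  by (rule card_ge_0_finite) (simp add: card_carrier_vec)

text \<open>Modulo \<open>W\<close> every vector is a multiple of \<open>w\<close>, and the multiple
  is unique because \<open>w\<close> lies outside \<open>W\<close>. The factor is therefore linear
  in the vector, and its values on the unit vectors are the coefficients of the form.\<close>

lemma separating_functional_codim_one:
  fixes W :: "'a :: field vec set"
  assumes W: "VectorSpace.subspace class_ring W (module_vec TYPE('a) n)"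
    and w: "w \<in> carrier_vec n" "w \<notin> W"
    and gen: "\<And>z. z \<in> carrier_vec n \<Longrightarrow> \<exists>c. z - c \<cdot>\<^sub>v w \<in> W"
  obtains f where "f \<in> carrier_vec n" "f \<bullet> w = 1" "\<And>z. z \<in> W \<Longrightarrow> f \<bullet> z = 0"
proof -
  have Wc: "W \<subseteq> carrier_vec n" and W0: "0\<^sub>v n \<in> W"
    and Wadd: "\<And>v w. v \<in> W \<Longrightarrow> w \<in> W \<Longrightarrow> v + w \<in> W"
    and Wsm: "\<And>c v. v \<in> W \<Longrightarrow> c \<cdot>\<^sub>v v \<in> W"
    using W unfolding subspace_vec_iff by auto
  obtain F where F: "\<And>z. z \<in> carrier_vec n \<Longrightarrow> z - F z \<cdot>\<^sub>v w \<in> W"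
    using gen by metis
  \<comment> \<open>\<open>F\<close> is a mere choice of factors, not known to be linear, so it is
    sampled on the unit vectors only.\<close>
  define f where "f = vec n (\<lambda>k. F (unit_vec n k))"
  have fc: "f \<in> carrier_vec n" by (simp add: f_def)
  \<comment> \<open>Induction on the support: \<open>z\<close> vanishes from coordinate
    \<open>k\<close> on, and the step splits off the component along one unit vector.\<close>
  have part: "z - (f \<bullet> z) \<cdot>\<^sub>v w \<in> W"
    if "k \<le> n" "z \<in> carrier_vec n" "\<forall>l<n. l \<ge> k \<longrightarrow> z $ l = 0" for k z
    using that
  proof (induction k arbitrary: z)
    case 0
    then have "z = 0\<^sub>v n" by (intro eq_vecI) auto
    then have "z - (f \<bullet> z) \<cdot>\<^sub>v w = 0\<^sub>v n" using w fc by (intro eq_vecI) auto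
    then show ?case using W0 by simp
  next
    case (Suc k)
    define e where "e = (unit_vec n k :: 'a vec)"
    define z' where "z' = z - (z $ k) \<cdot>\<^sub>v e"
    have e: "e \<in> carrier_vec n" and z': "z' \<in> carrier_vec n"
      using Suc.prems by (auto simp: e_def z'_def)
    have "z' - (f \<bullet> z') \<cdot>\<^sub>v w \<in> W"
    proof (rule Suc.IH)
      show "\<forall>l<n. k \<le> l \<longrightarrow> z' $ l = 0"
      proof (intro allI impI)
        fix l assume "l < n" "k \<le> l"
        then show "z' $ l = 0" using Suc.prems
          by (cases "l = k") (auto simp: z'_def e_def)
      qed
    qed (use Suc.prems z' in auto)
    moreover have "(z $ k) \<cdot>\<^sub>v (e - F e \<cdot>\<^sub>v w) \<in> W"
      using F e Wsm by auto
    moreover have "f \<bullet> z = f \<bullet> z' + z $ k * F e"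
    proof -
      have "f \<bullet> z' = f \<bullet> z - f \<bullet> ((z $ k) \<cdot>\<^sub>v e)"
        using e fc Suc.prems unfolding z'_def by (intro scalar_prod_minus_distrib) auto
      also have "f \<bullet> ((z $ k) \<cdot>\<^sub>v e) = z $ k * (f \<bullet> e)"
        using e fc by simp
      also have "f \<bullet> e = F e"
        using fc Suc.prems unfolding e_def by (simp add: f_def)
      finally show ?thesis by simp
    qed
    then have "z - (f \<bullet> z) \<cdot>\<^sub>v w
        = (z' - (f \<bullet> z') \<cdot>\<^sub>v w) + (z $ k) \<cdot>\<^sub>v (e - F e \<cdot>\<^sub>v w)"
      using e z' w Suc.prems by (intro eq_vecI) (auto simp: z'_def algebra_simps)
    ultimately show ?case using Wadd by simp
  qed
  have part: "z - (f \<bullet> z) \<cdot>\<^sub>v w \<in> W" if "z \<in> carrier_vec n" for z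
    using part[of n z] that by auto
  have zero: "c = 0" if "c \<cdot>\<^sub>v w \<in> W" for c
  proof (rule ccontr)
    assume "c \<noteq> 0"
    then have "w = inverse c \<cdot>\<^sub>v (c \<cdot>\<^sub>v w)" by (simp add: smult_smult_assoc)
    then show False using Wsm[OF that, of "inverse c"] w by simp
  qed
  have "f \<bullet> w = 1"
  proof -
    have "w - (f \<bullet> w) \<cdot>\<^sub>v w = (1 - f \<bullet> w) \<cdot>\<^sub>v w"
      using w by (intro eq_vecI) (auto simp: algebra_simps)
    then show ?thesis using zero part[OF w(1)] by fastforce
  qed
  moreover have "f \<bullet> z = 0" if "z \<in> W" for z
  proof -
    have "(f \<bullet> z) \<cdot>\<^sub>v w = z + (- 1) \<cdot>\<^sub>v (z - (f \<bullet> z) \<cdot>\<^sub>v w)"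
      using w that Wc by (intro eq_vecI) auto
    also have "\<dots> \<in> W" using part that Wc Wadd Wsm by blast
    finally show ?thesis by (rule zero)
  qed
  ultimately show thesis using that fc by blast
qed

text \<open>Among the finitely many subspaces that contain \<open>U\<close> and avoid
  \<open>w\<close>, a maximal one has codimension one, with \<open>w\<close> spanning a complement.
  This reduces the claim to the preceding lemma.\<close>

lemma separating_functional:
  fixes U :: "'a :: {field, finite} vec set"
  assumes U: "VectorSpace.subspace class_ring U (module_vec TYPE('a) n)"
    and w: "w \<in> carrier_vec n" "w \<notin> U"
  obtains f where "f \<in> carrier_vec n" "f \<bullet> w = 1" "\<And>z. z \<in> U \<Longrightarrow> f \<bullet> z = 0"
proof -
  define S where
    "S = {W. VectorSpace.subspace class_ring W (module_vec TYPE('a) n) \<and> w \<notin> W}"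
  have "S \<subseteq> Pow (carrier_vec n)" by (auto simp: S_def subspace_vec_iff)
  then have "finite S" using finite_carrier_vec by (metis finite_Pow_iff finite_subset)
  moreover have "U \<in> S" using U w by (simp add: S_def)
  ultimately obtain W where W: "W \<in> S" "U \<subseteq> W" and max: "\<And>X. X \<in> S \<Longrightarrow> W \<subseteq> X \<Longrightarrow> X = W"
    by (metis finite_has_maximal2)
  have sub: "VectorSpace.subspace class_ring W (module_vec TYPE('a) n)" and wW: "w \<notin> W"
    using W by (auto simp: S_def)
  have Wc: "W \<subseteq> carrier_vec n" and W0: "0\<^sub>v n \<in> W"
    and Wadd: "\<And>v w. v \<in> W \<Longrightarrow> w \<in> W \<Longrightarrow> v + w \<in> W"
    and Wsm: "\<And>c v. v \<in> W \<Longrightarrow> c \<cdot>\<^sub>v v \<in> W"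
    using sub unfolding subspace_vec_iff by auto
  have "\<exists>c. z - c \<cdot>\<^sub>v w \<in> W" if z: "z \<in> carrier_vec n" for z
  proof (cases "z \<in> W")
    case True
    moreover have "z - 0 \<cdot>\<^sub>v w = z" using z w by (intro eq_vecI) auto
    ultimately show ?thesis by metis
  next
    case False
    \<comment> \<open>The subspace generated by \<open>W\<close> and \<open>z\<close> is strictly
      larger than \<open>W\<close>, so by maximality it contains \<open>w\<close>. Solving for
      \<open>z\<close> shows that \<open>z\<close> is a multiple of \<open>w\<close> modulo
      \<open>W\<close>.\<close>
    define X where "X = {v + c \<cdot>\<^sub>v z | v c. v \<in> W}"
    have XI: "v + c \<cdot>\<^sub>v z \<in> X" if "v \<in> W" for v c
      using that by (auto simp: X_def)
    have "VectorSpace.subspace class_ring X (module_vec TYPE('a) n)"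
      unfolding subspace_vec_iff
    proof (intro conjI ballI allI)
      show "X \<subseteq> carrier_vec n" using Wc z by (auto simp: X_def)
      have "0\<^sub>v n = 0\<^sub>v n + 0 \<cdot>\<^sub>v z" using z by (intro eq_vecI) auto
      then show "0\<^sub>v n \<in> X" using W0 XI by metis
    next
      fix x y assume "x \<in> X" "y \<in> X"
      then obtain v c v' c' where *: "x = v + c \<cdot>\<^sub>v z" "y = v' + c' \<cdot>\<^sub>v z" "v \<in> W" "v' \<in> W"
        by (auto simp: X_def)
      then have "v \<in> carrier_vec n" "v' \<in> carrier_vec n" using Wc by auto
      then have "x + y = (v + v') + (c + c') \<cdot>\<^sub>v z"
        using z * by (intro eq_vecI) (auto simp: algebra_simps)
      then show "x + y \<in> X" using XI Wadd * by metis
    next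
      fix d x assume "x \<in> X"
      then obtain v c where *: "x = v + c \<cdot>\<^sub>v z" "v \<in> W" by (auto simp: X_def)
      then have "v \<in> carrier_vec n" using Wc by auto
      then have "d \<cdot>\<^sub>v x = d \<cdot>\<^sub>v v + (d * c) \<cdot>\<^sub>v z"
        using z * by (intro eq_vecI) (auto simp: algebra_simps)
      then show "d \<cdot>\<^sub>v x \<in> X" using XI Wsm * by metis
    qed
    moreover have "W \<subseteq> X"
    proof
      fix v assume "v \<in> W"
      moreover have "v = v + 0 \<cdot>\<^sub>v z" using z Wc \<open>v \<in> W\<close> by (intro eq_vecI) auto
      ultimately show "v \<in> X" using XI by metis
    qed
    moreover have "z \<in> X"
    proof -
      have "z = 0\<^sub>v n + 1 \<cdot>\<^sub>v z" using z by simp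
      then show ?thesis using XI W0 by metis
    qed
    ultimately have "w \<in> X" using max[of X] False by (auto simp: S_def)
    then obtain v c where vc: "v \<in> W" "w = v + c \<cdot>\<^sub>v z" by (auto simp: X_def)
    have v: "v \<in> carrier_vec n" using vc Wc by auto
    have "c \<noteq> 0"
    proof
      assume "c = 0"
      then have "w = v" using vc v z by (intro eq_vecI) auto
      then show False using vc wW by simp
    qed
    then have "z - inverse c \<cdot>\<^sub>v w = (- inverse c) \<cdot>\<^sub>v v"
      using z v vc(2) by (intro eq_vecI) (auto simp: algebra_simps)
    then show ?thesis using Wsm vc by metis
  qed
  from separating_functional_codim_one[OF sub w(1) wW this] show thesis
    using that W(2) by (metis subsetD)
qed

text \<open>A form that vanishes on \<open>W\<close> but not at some \<open>w\<close> outside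
  \<open>W\<close> has a proper kernel containing \<open>W\<close>. A further vector of the kernel
  would extend a basis of \<open>W\<close> to a basis of the whole space lying inside the
  kernel.\<close>

lemma hyperplane_eq_kernel:
  fixes W :: "'a :: {field, finite} vec set"
  assumes W: "VectorSpace.subspace class_ring W (module_vec TYPE('a) n)"
    and dim: "Suc (vectorspace.dim class_ring ((module_vec TYPE('a) n)\<lparr>carrier := W\<rparr>)) = n"
  obtains f where "f \<in> carrier_vec n" "W = {z \<in> carrier_vec n. f \<bullet> z = 0}"
proof -
  interpret vec_space "TYPE('a)" n .
  have Wc: "W \<subseteq> carrier_vec n"
    using W unfolding subspace_vec_iff by auto
  have subm: "submodule class_ring W V" using W by (rule is_module)
  interpret WV: vectorspace class_ring "vs W"
    using W by (rule subspace_is_vs)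
  have "W \<noteq> carrier_vec n"
  proof
    assume "W = carrier_vec n"
    then have "vs W = V" by (simp add: module_vec_def)
    then show False using dim dim_is_n by simp
  qed
  then obtain w where w: "w \<in> carrier_vec n" "w \<notin> W" using Wc by auto
  obtain f where f: "f \<in> carrier_vec n" "f \<bullet> w = 1" "\<And>z. z \<in> W \<Longrightarrow> f \<bullet> z = 0"
    using separating_functional[OF W w] by metis
  define K where "K = {z \<in> carrier_vec n. f \<bullet> z = 0}"
  have K: "VectorSpace.subspace class_ring K V"
    unfolding subspace_vec_iff K_def using f(1)
    by (auto simp: scalar_prod_add_distrib[of _ n] scalar_prod_smult_distrib[of _ n])
  have finW: "finite W" using Wc finite_carrier_vec by (rule finite_subset)
  have "WV.fin_dim"
    unfolding WV.fin_dim_def using finW WV.span_is_subset2[of W] WV.in_own_span[of W]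
    by (intro exI[of _ W]) auto
  then obtain B where B: "finite B" "WV.basis B" using WV.finite_basis_exists by auto
  have BW: "B \<subseteq> W" using B by (simp add: WV.basis_def)
  \<comment> \<open>Independence and span have the same meaning inside \<open>W\<close> and in the
    ambient space, so the basis of \<open>W\<close> can be extended there.\<close>
  have liB: "lin_indpt B"
    using B span_li_not_depend(2)[OF BW subm] by (simp add: WV.basis_def)
  have spB: "span B = W"
    using B span_li_not_depend(1)[OF BW subm] by (simp add: WV.basis_def)
  have cardB: "Suc (card B) = n" using WV.dim_basis[OF B] dim by simp
  have "z \<in> W" if z: "z \<in> K" for z
  proof (rule ccontr)
    assume "z \<notin> W"
    have zc: "z \<in> carrier_vec n" using z by (simp add: K_def)
    have Bc: "B \<subseteq> carrier_vec n" using BW Wc by auto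
    have "z \<notin> B" using \<open>z \<notin> W\<close> BW by auto
    then have "lin_indpt (B \<union> {z})"
      using lin_dep_iff_in_span[OF Bc liB] zc spB \<open>z \<notin> W\<close> by auto
    then have "basis (B \<union> {z})"
      using \<open>z \<notin> B\<close> B(1) Bc zc cardB by (intro dim_li_is_basis) (auto simp: dim_is_n)
    then have "carrier_vec n = span (B \<union> {z})" by (simp add: basis_def)
    also have "\<dots> \<subseteq> K"
      using BW z f(3) Wc K by (intro span_is_subset) (auto simp: K_def)
    finally show False using w f(2) by (auto simp: K_def)
  qed
  then have "W = K" using f(3) Wc by (auto simp: K_def)
  then show thesis using that f(1) by (simp add: K_def)
qed

text \<open>This is where containments between hyperplanes become scalars. If \<open>u\<close> has a
  nonzero entry at \<open>l\<close>, the vectors \<open>u $ l\<close> e_k - \<open>u $ k\<close> e_l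
  lie in the kernel of \<open>u\<close>, and evaluating \<open>u'\<close> on them makes its entries
  proportional to those of \<open>u\<close>.\<close>

lemma kernel_subset_imp_multiple:
  fixes u u' :: "'a :: field vec"
  assumes u: "u \<in> carrier_vec n" "u' \<in> carrier_vec n"
    and ker: "\<And>x. x \<in> carrier_vec n \<Longrightarrow> x \<bullet> u = 0 \<Longrightarrow> x \<bullet> u' = 0"
  obtains a where "u' = a \<cdot>\<^sub>v u"
proof (cases "u = 0\<^sub>v n")
  case True
  have "u' $ k = 0" if "k < n" for k
    using ker[of "unit_vec n k"] that u True by simp
  then have "u' = 0 \<cdot>\<^sub>v u" using u by (intro eq_vecI) auto
  then show thesis by (rule that)
next
  case False
  then obtain l where l: "l < n" "u $ l \<noteq> 0" using u by (metis carrier_vecD eq_vecI index_zero_vec)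
  have "u' $ k = u' $ l / u $ l * u $ k" if k: "k < n" for k
  proof -
    have eq: "(u $ l \<cdot>\<^sub>v unit_vec n k - u $ k \<cdot>\<^sub>v unit_vec n l) \<bullet> y = u $ l * y $ k - u $ k * y $ l"
      if "y \<in> carrier_vec n" for y
      using k l that by (simp add: minus_scalar_prod_distrib[of _ n])
    have "u $ l * u' $ k - u $ k * u' $ l = 0"
      using ker[of "u $ l \<cdot>\<^sub>v unit_vec n k - u $ k \<cdot>\<^sub>v unit_vec n l"] eq u by simp
    then show ?thesis using l by (simp add: field_simps)
  qed
  then have "u' = (u' $ l / u $ l) \<cdot>\<^sub>v u" using u by (intro eq_vecI) auto
  then show thesis by (rule that)
qed

section \<open>Multiplicative order in finite fields\<close>

lemma two_le_card_field: "CARD('a :: {field, finite}) \<ge> 2"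
proof -
  have "card {0, 1 :: 'a} \<le> CARD('a)" by (intro card_mono) auto
  then show ?thesis by simp
qed

text \<open>Multiplication by \<open>x\<close> permutes the nonzero elements, so it leaves their
  product unchanged; that product is nonzero and cancels.\<close>

lemma finite_field_power_card_minus_one:
  fixes x :: "'a :: {field, finite}"
  assumes "x \<noteq> 0"
  shows "x ^ (CARD('a) - 1) = 1"
proof -
  have "(\<Prod>y\<in>UNIV - {0}. x * y) = (\<Prod>y\<in>UNIV - {0}. y)"
    by (rule prod.reindex_bij_witness[of _ "\<lambda>y. y / x" "\<lambda>y. x * y"]) (use assms in auto)
  then have "x ^ (CARD('a) - 1) * (\<Prod>y\<in>UNIV - {0 :: 'a}. y) = 1 * (\<Prod>y\<in>UNIV - {0}. y)"
    by (simp add: prod.distrib card_Diff_singleton)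
  moreover have "(\<Prod>y\<in>UNIV - {0 :: 'a}. y) \<noteq> 0" by (subst prod_zero_iff) auto
  ultimately show ?thesis using mult_right_cancel by blast
qed

lemma primitive_element_nonzero:
  assumes "primitive_element g"
  shows "g \<noteq> 0"
proof -
  have "g powi 1 \<in> UNIV - {0}" using assms unfolding primitive_element_def by blast
  then show ?thesis by simp
qed

text \<open>Primitivity provides an integer exponent, possibly negative; its remainder modulo
  \<open>m\<close> is a natural number giving the same power. Any positive \<open>m\<close> with
  \<open>g ^ m = 1\<close> will do, which allows a count of the powers against a hypothetical small
  exponent.\<close>

lemma primitive_element_powers:
  assumes "primitive_element g" "g ^ m = 1" "m > 0" "x \<noteq> 0"
  obtains k where "k < m" "x = g ^ k"
proof -
  have g: "g \<noteq> 0" by (rule primitive_element_nonzero) fact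
  have "x \<in> range (\<lambda>k :: int. g powi k)"
    using assms(1,4) unfolding primitive_element_def by blast
  then obtain k :: int where k: "x = g powi k" by auto
  have "g powi k = g powi (int m * (k div int m) + k mod int m)" by simp
  also have "\<dots> = (g powi int m) powi (k div int m) * g powi (k mod int m)"
    using g by (subst power_int_add) (auto simp: power_int_mult)
  also have "\<dots> = g powi int (nat (k mod int m))"
    using assms by (simp add: power_int_of_nat)
  also have "\<dots> = g ^ nat (k mod int m)" by (rule power_int_of_nat)
  finally have "x = g ^ nat (k mod int m)" using k by simp
  moreover have "nat (k mod int m) < m" using assms(3) by (simp add: nat_less_iff)
  ultimately show thesis using that by blast
qed

text \<open>Otherwise the remainder \<open>n\<close> of \<open>m\<close> would be a positive
  exponent with \<open>g ^ n = 1\<close>, and the fewer than \<open>CARD('b) - 1\<close> powers of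
  \<open>g\<close> could not exhaust the nonzero elements.\<close>

lemma primitive_element_order_dvd:
  fixes g :: "'b :: {field, finite}"
  assumes g: "primitive_element g" and "g ^ m = 1"
  shows "CARD('b) - 1 dvd m"
proof (rule ccontr)
  define n where "n = m mod (CARD('b) - 1)"
  assume "\<not> CARD('b) - 1 dvd m"
  then have n: "0 < n" by (simp only: n_def mod_greater_zero_iff_not_dvd not_False_eq_True)
  have "CARD('b) \<ge> 2" by (rule two_le_card_field)
  then have n2: "n < CARD('b) - 1" by (auto simp: n_def intro: mod_less_divisor)
  have "g ^ m = (g ^ (CARD('b) - 1)) ^ (m div (CARD('b) - 1)) * g ^ n"
    unfolding n_def power_mult[symmetric] power_add[symmetric] by simp
  then have "g ^ n = 1"
    using assms finite_field_power_card_minus_one[OF primitive_element_nonzero[OF g]] by simp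
  then have "UNIV - {0} \<subseteq> (\<lambda>k. g ^ k) ` {..<n}"
    using primitive_element_powers[OF g _ n] by (metis DiffE image_eqI insertI1 lessThan_iff subsetI)
  then have "card (UNIV - {0 :: 'b}) \<le> card {..<n}"
    by (metis card_image_le card_mono finite_imageI finite_lessThan order_trans)
  then show False using n2 by (simp add: card_Diff_singleton)
qed

section \<open>Minimal polynomial, companion matrix and the power basis\<close>

lemma poly_map_poly_eq_sum:
  assumes "field_hom h" "degree f \<le> n"
  shows "poly (map_poly h f) g = (\<Sum>k\<le>n. h (coeff f k) * g ^ k)"
proof -
  interpret field_hom h by fact
  have "(\<Sum>k\<le>degree f. h (coeff f k) * g ^ k) = (\<Sum>k\<le>n. h (coeff f k) * g ^ k)"
    using assms(2) by (intro sum.mono_neutral_left) (auto simp: coeff_eq_0)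
  then show ?thesis by (simp add: poly_altdef)
qed

text \<open>The definite description needs existence and uniqueness. Some nonzero polynomial
  annihilates \<open>g\<close>, and one of least degree can be made monic; the difference of two
  such monic polynomials annihilates \<open>g\<close> in smaller degree, hence vanishes.\<close>

lemma min_poly_is_minimal:
  fixes h :: "'a :: field \<Rightarrow> 'b :: {field, finite}"
  assumes h: "field_hom h"
  shows "monic (min_poly h g)" "poly (map_poly h (min_poly h g)) g = 0"
    "f \<noteq> 0 \<Longrightarrow> poly (map_poly h f) g = 0 \<Longrightarrow> degree (min_poly h g) \<le> degree f"
proof -
  interpret field_hom h by fact
  interpret mh: map_poly_comm_ring_hom h ..
  define P where "P = (\<lambda>p. monic p \<and> poly (map_poly h p) g = 0 \<and>
     (\<forall>f. f \<noteq> 0 \<and> poly (map_poly h f) g = 0 \<longrightarrow> degree p \<le> degree f))"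
  define R where "R = (\<lambda>f. f \<noteq> 0 \<and> poly (map_poly h f) g = 0)"
  have "\<exists>f. R f"
  proof (cases "g = 0")
    case True
    then show ?thesis by (intro exI[of _ "monom 1 1"]) (simp add: R_def poly_monom)
  next
    case False
    have "CARD('b) \<ge> 2" by (rule two_le_card_field)
    \<comment> \<open>The exponent is positive, so subtracting the constant 1 leaves the leading
      coefficient alone and the polynomial is nonzero.\<close>
    then have "coeff (monom 1 (CARD('b) - 1) - 1 :: 'a poly) (CARD('b) - 1) = 1" by simp
    then have "monom 1 (CARD('b) - 1) - 1 \<noteq> (0 :: 'a poly)" by (metis coeff_0 zero_neq_one)
    then show ?thesis using finite_field_power_card_minus_one[OF False]
      by (intro exI[of _ "monom 1 (CARD('b) - 1) - 1"]) (simp add: R_def poly_monom hom_distribs)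
  qed
  then obtain f0 where f0: "R f0" "\<And>f. R f \<Longrightarrow> degree f0 \<le> degree f"
    by (metis (no_types) ex_has_least_nat[of R _ degree])
  define p where "p = smult (inverse (lead_coeff f0)) f0"
  have "P p" using f0 by (auto simp: P_def R_def p_def hom_distribs)
  moreover have "p1 = p2" if p: "P p1" "P p2" for p1 p2
  proof (rule ccontr)
    assume ne: "p1 \<noteq> p2"
    have "p1 \<noteq> 0" "p2 \<noteq> 0" using p by (auto simp: P_def)
    then have deg: "degree p1 = degree p2" using p by (auto simp: P_def intro!: antisym)
    then have "degree (p1 - p2) \<le> degree p1" "coeff (p1 - p2) (degree p1) = 0"
      using p by (auto simp: P_def intro: degree_diff_le)
    then have "degree (p1 - p2) < degree p1"
      using eq_zero_or_degree_less ne by fastforce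
    moreover have "poly (map_poly h (p1 - p2)) g = 0" using p by (simp add: P_def hom_distribs)
    ultimately show False using p ne unfolding P_def by (metis leD right_minus_eq)
  qed
  ultimately have "P (min_poly h g)"
    unfolding min_poly_def P_def[symmetric] by (metis theI)
  then show "monic (min_poly h g)" "poly (map_poly h (min_poly h g)) g = 0"
    "f \<noteq> 0 \<Longrightarrow> poly (map_poly h f) g = 0 \<Longrightarrow> degree (min_poly h g) \<le> degree f"
    by (auto simp: P_def)
qed

text \<open>The map goes from coordinates to field elements, so it makes sense before the powers of
  \<open>g\<close> are known to form a basis.\<close>

definition power_coords :: "('a :: field \<Rightarrow> 'b :: field) \<Rightarrow> 'b \<Rightarrow> 'a vec \<Rightarrow> 'b" where
  "power_coords h g c = (\<Sum>k<dim_vec c. h (c $ k) * g ^ k)"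

context
  fixes h :: "'a :: field \<Rightarrow> 'b :: field" and g :: 'b
  assumes h: "field_hom h"
begin

interpretation field_hom h by (rule h)

lemma power_coords_add:
  assumes "c \<in> carrier_vec n" "c' \<in> carrier_vec n"
  shows "power_coords h g (c + c') = power_coords h g c + power_coords h g c'"
proof -
  have "power_coords h g (c + c') = (\<Sum>k<n. h (c $ k) * g ^ k + h (c' $ k) * g ^ k)"
    unfolding power_coords_def using assms
    by (intro sum.cong) (auto simp: hom_add distrib_right)
  also have "\<dots> = power_coords h g c + power_coords h g c'"
    unfolding power_coords_def sum.distrib using assms by simp
  finally show ?thesis .
qed

lemma power_coords_smult: "power_coords h g (a \<cdot>\<^sub>v c) = h a * power_coords h g c"
  by (simp add: power_coords_def sum_distrib_left hom_mult mult.assoc)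

text \<open>Column \<open>l\<close> of the companion matrix represents \<open>g ^ Suc l\<close>:
  through the subdiagonal for all but the last column, and through the relation p(g) = 0 for the
  last. Hence the matrix acts as multiplication by \<open>g\<close>.\<close>

lemma power_coords_companion_mat:
  assumes p: "monic p" "poly (map_poly h p) g = 0" and c: "c \<in> carrier_vec (degree p)"
  shows "power_coords h g (companion_mat p *\<^sub>v c) = g * power_coords h g c"
proof -
  define d where "d = degree p"
  define A where "A = companion_mat p"
  have A: "A \<in> carrier_mat d d" by (simp add: A_def d_def companion_mat_def)
  have col: "(\<Sum>k<d. h (A $$ (k, l)) * g ^ k) = g ^ Suc l" if l: "l < d" for l
  proof (cases "Suc l = d")
    case True
    have "(\<Sum>k<d. h (A $$ (k, l)) * g ^ k) = - (\<Sum>k<d. h (coeff p k) * g ^ k)"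
      using True l unfolding sum_negf[symmetric]
      by (intro sum.cong) (auto simp: A_def companion_mat_def d_def hom_uminus)
    moreover have "(\<Sum>k<d. h (coeff p k) * g ^ k) + g ^ d = 0"
      using poly_map_poly_eq_sum[OF h order_refl, of p g] p
      by (simp add: d_def lessThan_Suc_atMost[symmetric])
    ultimately show ?thesis using True by (metis add_eq_0_iff)
  next
    case False
    have "(\<Sum>k<d. h (A $$ (k, l)) * g ^ k) = (\<Sum>k<d. if k = Suc l then g ^ k else 0)"
      using False l by (intro sum.cong) (auto simp: A_def companion_mat_def d_def)
    then show ?thesis using False l by simp
  qed
  have "power_coords h g (A *\<^sub>v c) = (\<Sum>k<d. \<Sum>l<d. h (A $$ (k, l)) * g ^ k * h (c $ l))"
    using A c unfolding power_coords_def d_def[symmetric]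
    by (auto simp: scalar_prod_def hom_sum hom_mult sum_distrib_left mult_ac atLeast0LessThan d_def
        intro!: sum.cong)
  also have "\<dots> = (\<Sum>l<d. (\<Sum>k<d. h (A $$ (k, l)) * g ^ k) * h (c $ l))"
    by (subst sum.swap) (simp add: sum_distrib_right)
  also have "\<dots> = (\<Sum>l<d. g ^ Suc l * h (c $ l))"
    by (intro sum.cong) (simp_all only: col lessThan_iff)
  also have "\<dots> = g * power_coords h g c"
    using c by (simp add: power_coords_def sum_distrib_left d_def mult_ac)
  finally show ?thesis by (simp add: A_def)
qed

lemma power_coords_companion_mat_power:
  assumes p: "monic p" "poly (map_poly h p) g = 0" and c: "c \<in> carrier_vec (degree p)"
  shows "power_coords h g (companion_mat p ^\<^sub>m k *\<^sub>v c) = g ^ k * power_coords h g c"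
  using c
proof (induction k arbitrary: c)
  case 0
  then show ?case by (simp add: companion_mat_def)
next
  case (Suc k)
  have A: "companion_mat p \<in> carrier_mat (degree p) (degree p)"
    by (simp add: companion_mat_def)
  then have "companion_mat p *\<^sub>v c \<in> carrier_vec (degree p)" using Suc.prems by simp
  then show ?case
    using Suc A p power_coords_companion_mat[OF p Suc.prems]
    by (simp add: assoc_mult_mat_vec[of _ "degree p" "degree p"] mult_ac)
qed

text \<open>The entries of \<open>c\<close> are the coefficients of a polynomial of degree below
  \<open>n\<close> that annihilates \<open>g\<close>, and only the zero polynomial
  qualifies.\<close>

lemma power_coords_eq_0_imp:
  assumes min: "\<And>f. f \<noteq> 0 \<Longrightarrow> poly (map_poly h f) g = 0 \<Longrightarrow> n \<le> degree f"
    and c: "c \<in> carrier_vec n" "power_coords h g c = 0"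
  shows "c = 0\<^sub>v n"
proof -
  define f where "f = (\<Sum>k<n. monom (c $ k) k)"
  have cf: "coeff f k = (if k < n then c $ k else 0)" for k
    by (simp add: f_def coeff_sum)
  have "f = 0"
  proof (rule ccontr)
    assume "f \<noteq> 0"
    then have "degree f < n" using cf by (metis leading_coeff_0_iff)
    then have "poly (map_poly h f) g = (\<Sum>k\<le>n. h (coeff f k) * g ^ k)"
      by (intro poly_map_poly_eq_sum[OF h]) simp
    also have "\<dots> = power_coords h g c"
      using c by (simp add: lessThan_Suc_atMost[symmetric] cf power_coords_def)
    finally show False using min[OF \<open>f \<noteq> 0\<close>] c(2) \<open>degree f < n\<close> by simp
  qed
  then show ?thesis using c(1) cf by (intro eq_vecI) (auto, metis coeff_0)
qed

end

text \<open>With d the degree, \<open>power_coords\<close> is a bijection from vectors of length d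
  onto the extension field, so counting gives d = r. It is onto because each power of
  \<open>g\<close> is represented by a power of the companion matrix applied to the first unit
  vector.\<close>

lemma degree_min_poly_primitive_element:
  fixes h :: "'a :: {field, finite} \<Rightarrow> 'b :: {field, finite}"
  assumes h: "field_hom h" and g: "primitive_element g" and card: "CARD('b) = CARD('a) ^ r"
  shows "degree (min_poly h g) = r"
proof -
  interpret field_hom h by fact
  define p where "p = min_poly h g"
  note p = min_poly_is_minimal[OF h, where g = g, folded p_def]
  define d where "d = degree p"
  have inj: "inj_on (power_coords h g) (carrier_vec d)"
  proof (rule inj_onI)
    fix c c' assume c: "c \<in> carrier_vec d" "c' \<in> carrier_vec d"
      and eq: "power_coords h g c = power_coords h g c'"
    have "power_coords h g (c + (- 1) \<cdot>\<^sub>v c') = 0"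
      using c eq by (simp add: power_coords_add[OF h, of _ d] power_coords_smult[OF h] hom_uminus)
    then have "c + (- 1) \<cdot>\<^sub>v c' = 0\<^sub>v d"
      using c p(3) by (intro power_coords_eq_0_imp[OF h, of g d]) (auto simp: d_def)
    then show "c = c'"
      using c by (intro eq_vecI) (auto simp: vec_eq_iff)
  qed
  \<comment> \<open>Only for positive \<open>d\<close> is there a first unit vector to represent
    1.\<close>
  have "d \<noteq> 0"
  proof
    assume "d = 0"
    then have "p = 1" using p(1) by (metis d_def monic_degree_0)
    then show False using p(2) by simp
  qed
  then have "power_coords h g (unit_vec d 0) = (\<Sum>k<d. if k = 0 then 1 else 0)"
    unfolding power_coords_def by (intro sum.cong) auto
  also have "\<dots> = 1" using \<open>d \<noteq> 0\<close> by simp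
  finally have one: "power_coords h g (unit_vec d 0) = 1" .
  have "x \<in> power_coords h g ` carrier_vec d" for x
  proof (cases "x = 0")
    case True
    have "power_coords h g (0\<^sub>v d) = 0" by (simp add: power_coords_def)
    then show ?thesis using True by (metis image_eqI zero_carrier_vec)
  next
    case False
    have "CARD('b) \<ge> 2" by (rule two_le_card_field)
    then obtain k where "x = g ^ k"
      using primitive_element_powers[OF g finite_field_power_card_minus_one[OF
            primitive_element_nonzero[OF g]] _ False] by auto
    then have "x = power_coords h g (companion_mat p ^\<^sub>m k *\<^sub>v unit_vec d 0)"
      using power_coords_companion_mat_power[OF h p(1,2), of "unit_vec d 0" k] one
      by (simp add: d_def)
    moreover have "companion_mat p ^\<^sub>m k \<in> carrier_mat d d"
      by (intro pow_carrier_mat) (simp add: companion_mat_def d_def)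
    ultimately show ?thesis by (metis image_eqI mult_mat_vec_carrier unit_vec_carrier)
  qed
  then have "power_coords h g ` carrier_vec d = UNIV" by auto
  then have "CARD('b) = CARD('a) ^ d"
    using card_image[OF inj] by (simp add: card_carrier_vec)
  moreover have "CARD('a) \<ge> 2" by (rule two_le_card_field)
  ultimately show ?thesis using card by (simp add: d_def p_def power_inject_exp)
qed

section \<open>Projective points and the action on row vectors\<close>

lemma proj_pt_in_PG:
  "z \<in> carrier_vec (N + 1) \<Longrightarrow> z \<noteq> 0\<^sub>v (N + 1) \<Longrightarrow> proj_pt N z \<in> PG N"
  by (auto simp: PG_def proj_pt_def quotient_def)

text \<open>Subspaces are closed under scaling, so membership of a point does not depend on the
  chosen representative.\<close>

lemma proj_pt_in_proj_of_iff:
  fixes U :: "'a :: field vec set"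
  assumes U: "VectorSpace.subspace class_ring U (module_vec TYPE('a) (N + 1))"
    and z: "z \<in> carrier_vec (N + 1)" "z \<noteq> 0\<^sub>v (N + 1)"
  shows "proj_pt N z \<in> proj_of N U \<longleftrightarrow> z \<in> U"
proof
  assume "proj_pt N z \<in> proj_of N U"
  then obtain u where u: "u \<in> U" "proj_pt N z = proj_pt N u" by (auto simp: proj_of_def)
  have "(z, z) \<in> proj_rel N" using z by (auto simp: proj_rel_def intro!: exI[of _ 1])
  then have "(u, z) \<in> proj_rel N" using u(2) by (auto simp: proj_pt_def)
  then show "z \<in> U" using U u(1) by (auto simp: proj_rel_def subspace_vec_iff)
qed (use z in \<open>auto simp: proj_of_def\<close>)

lemma row_mult_carrier: "A \<in> carrier_mat m n \<Longrightarrow> row_mult x A \<in> carrier_vec n"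
  by (simp add: row_mult_def)

lemma row_mult_zero: "A \<in> carrier_mat m n \<Longrightarrow> row_mult (0\<^sub>v m) A = 0\<^sub>v n"
  by (intro eq_vecI) (auto simp: row_mult_def)

text \<open>The spread is defined by an action on row vectors; this moves the matrix to the column
  vector of a form, where it becomes multiplication by a power of \<gamma>.\<close>

lemma row_mult_scalar_prod:
  assumes "A \<in> carrier_mat m n" "x \<in> carrier_vec m" "v \<in> carrier_vec n"
  shows "row_mult x A \<bullet> v = x \<bullet> (A *\<^sub>v v)"
proof -
  have "row_mult x A = transpose_mat A *\<^sub>v x"
    using assms by (intro eq_vecI) (auto simp: row_mult_def intro!: comm_scalar_prod[of _ m])
  then show ?thesis using transpose_vec_mult_scalar[OF assms(1,3,2)] by simp
qed

section \<open>Comparing two forms on the spread elements\<close>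

text \<open>Each hypothesis is a proportionality between \<alpha> and a power of \<open>g\<close>
  times \<beta>, with factors from the base field. Dividing one by the other eliminates \<alpha> and
  \<beta>.\<close>

lemma power_in_base_field:
  assumes h: "field_hom h" and "g \<noteq> 0" "i \<le> j" "\<alpha> \<noteq> 0" "\<beta> \<noteq> 0" "a \<noteq> b"
    and c: "h a * \<alpha> + g ^ i * (h b * \<beta>) = h c * (\<alpha> + g ^ i * \<beta>)"
    and d: "h a * \<alpha> + g ^ j * (h b * \<beta>) = h d * (\<alpha> + g ^ j * \<beta>)"
  obtains t where "t \<noteq> 0" "g ^ (j - i) = h t"
proof -
  interpret field_hom h by fact
  \<comment> \<open>If one of the factors \<open>a - e\<close> and \<open>e - b\<close> vanished, so
    would the other, against \<open>a \<noteq> b\<close>.\<close>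
  have *: "h (a - e) * \<alpha> = h (e - b) * (g ^ k * \<beta>) \<and> a \<noteq> e \<and> e \<noteq> b"
    if "h a * \<alpha> + g ^ k * (h b * \<beta>) = h e * (\<alpha> + g ^ k * \<beta>)" for k e
  proof -
    have eq: "h (a - e) * \<alpha> = h (e - b) * (g ^ k * \<beta>)"
      using that by (simp add: hom_minus algebra_simps)
    then show ?thesis using assms by auto
  qed
  define t where "t = (c - b) * (a - d) / ((a - c) * (d - b))"
  note c = *[OF c] and d = *[OF d]
  have "(h (c - b) * (g ^ i * \<beta>)) * (h (a - d) * \<alpha>) =
      (h (a - c) * \<alpha>) * (h (d - b) * (g ^ j * \<beta>))"
    using c d by simp
  then have "h ((c - b) * (a - d)) * (g ^ i * \<beta> * \<alpha>) = h ((a - c) * (d - b)) * (g ^ j * \<beta> * \<alpha>)"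
    by (simp only: hom_mult mult_ac)
  moreover have "g ^ j = g ^ i * g ^ (j - i)"
    using assms(3) by (simp flip: power_add)
  ultimately have "h ((c - b) * (a - d)) = h ((a - c) * (d - b)) * g ^ (j - i)"
    using assms by simp
  moreover have "h ((a - c) * (d - b)) \<noteq> 0" using c d by simp
  ultimately have "g ^ (j - i) = h t"
    unfolding t_def hom_div by (metis nonzero_mult_div_cancel_left)
  moreover have "t \<noteq> 0" using c d by (simp add: t_def)
  ultimately show thesis using that by blast
qed

text \<open>Since q is 1 modulo q - 1, the division is exact, and the positive factor q - 1
  cancels.\<close>

lemma repunit_dvd:
  fixes q k :: nat
  assumes "q \<ge> 2" "q ^ r - 1 dvd k * (q - 1)"
  shows "(q ^ r - 1) div (q - 1) dvd k"
proof -
  have "[q = 1] (mod q - 1)" using assms(1) by (simp add: cong_altdef_nat)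
  then have "[q ^ r = 1 ^ r] (mod q - 1)" by (rule cong_pow)
  then have "q - 1 dvd q ^ r - 1" using assms(1) by (simp add: cong_altdef_nat)
  then obtain m where m: "q ^ r - 1 = (q - 1) * m" ..
  then show ?thesis using assms by (simp add: mult.commute[of k])
qed

text \<open>The theorem in dual form, for the hyperplane that is the kernel of \<open>(u, v)\<close>.\<close>

lemma dual_cutting:
  fixes h :: "'a :: {field, finite} \<Rightarrow> 'b :: {field, finite}"
  assumes h: "field_hom h" and g: "primitive_element g" and card: "CARD('b) = CARD('a) ^ r"
    and M: "M = companion_mat (min_poly h g)" and ij: "i \<le> j"
    and ndvd: "\<not> (CARD('a) ^ r - 1) div (CARD('a) - 1) dvd j - i"
    and uv: "u \<in> carrier_vec r" "v \<in> carrier_vec r" "u' \<in> carrier_vec r" "v' \<in> carrier_vec r"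
    and V0: "\<And>x. x \<in> carrier_vec r \<Longrightarrow> x \<bullet> u = 0 \<Longrightarrow> x \<bullet> u' = 0"
    and Vinf: "\<And>x. x \<in> carrier_vec r \<Longrightarrow> x \<bullet> v = 0 \<Longrightarrow> x \<bullet> v' = 0"
    and V: "\<And>x k. k \<in> {i, j} \<Longrightarrow> x \<in> carrier_vec r \<Longrightarrow> x \<bullet> (u + M ^\<^sub>m k *\<^sub>v v) = 0 \<Longrightarrow>
              x \<bullet> (u' + M ^\<^sub>m k *\<^sub>v v') = 0"
  obtains a where "u' = a \<cdot>\<^sub>v u" "v' = a \<cdot>\<^sub>v v"
proof -
  interpret field_hom h by fact
  define p where "p = min_poly h g"
  note p = min_poly_is_minimal[OF h, where g = g, folded p_def]
  have deg: "degree p = r" using degree_min_poly_primitive_element[OF h g card] by (simp add: p_def)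
  have Mk: "M ^\<^sub>m k \<in> carrier_mat r r" for k
    by (intro pow_carrier_mat) (simp add: M companion_mat_def deg flip: p_def)
  let ?\<phi> = "power_coords h g"
  have \<phi>_M: "?\<phi> (M ^\<^sub>m k *\<^sub>v x) = g ^ k * ?\<phi> x" if "x \<in> carrier_vec r" for k x
    using power_coords_companion_mat_power[OF h p(1,2)] that by (simp add: M deg flip: p_def)
  have \<phi>_0: "x = 0\<^sub>v r" if "x \<in> carrier_vec r" "?\<phi> x = 0" for x
    using power_coords_eq_0_imp[OF h _ that] p(3) deg by blast
  obtain a where a: "u' = a \<cdot>\<^sub>v u" using kernel_subset_imp_multiple[OF uv(1,3) V0] by blast
  obtain b where b: "v' = b \<cdot>\<^sub>v v" using kernel_subset_imp_multiple[OF uv(2,4) Vinf] by blast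
  \<comment> \<open>The vector \<open>u + M ^\<^sub>m k *\<^sub>v v\<close> is the form (u, v)
    pulled back to V_k. The containment of kernels there yields the scalar \<open>c\<close>, and
    \<open>power_coords\<close> turns the matrix power into \<open>g ^ k\<close>.\<close>
  have *: "\<exists>c. h a * ?\<phi> u + g ^ k * (h b * ?\<phi> v) = h c * (?\<phi> u + g ^ k * ?\<phi> v)"
    if k: "k \<in> {i, j}" for k
  proof -
    have Mv: "M ^\<^sub>m k *\<^sub>v v \<in> carrier_vec r" "M ^\<^sub>m k *\<^sub>v v' \<in> carrier_vec r"
      using mult_mat_vec_carrier[OF Mk] uv by auto
    then have "u + M ^\<^sub>m k *\<^sub>v v \<in> carrier_vec r" "u' + M ^\<^sub>m k *\<^sub>v v' \<in> carrier_vec r"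
      using uv by auto
    from kernel_subset_imp_multiple[OF this V[OF k]]
    obtain c where "u' + M ^\<^sub>m k *\<^sub>v v' = c \<cdot>\<^sub>v (u + M ^\<^sub>m k *\<^sub>v v)" by blast
    then have "?\<phi> (u' + M ^\<^sub>m k *\<^sub>v v') = ?\<phi> (c \<cdot>\<^sub>v (u + M ^\<^sub>m k *\<^sub>v v))" by simp
    then have "?\<phi> u' + g ^ k * ?\<phi> v' = h c * (?\<phi> u + g ^ k * ?\<phi> v)"
      using uv Mv by (simp add: power_coords_add[OF h, of _ r] power_coords_smult[OF h] \<phi>_M)
    then show ?thesis by (auto simp: a b power_coords_smult[OF h])
  qed
  \<comment> \<open>When one half of the form is zero, any scalar serves for it, so the scalar of
    the other half can be used for both.\<close>
  consider "u = 0\<^sub>v r" | "v = 0\<^sub>v r" | "a = b" | "?\<phi> u \<noteq> 0" "?\<phi> v \<noteq> 0" "a \<noteq> b"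
    using \<phi>_0 uv by blast
  then show thesis
  proof cases
    case 1
    then have "u' = b \<cdot>\<^sub>v u" using a by (auto intro!: eq_vecI)
    then show thesis using that b by blast
  next
    case 2
    then have "v' = a \<cdot>\<^sub>v v" using b by (auto intro!: eq_vecI)
    then show thesis using that a by blast
  next
    case 3
    then show thesis using that a b by blast
  next
    case 4
    obtain c d where
      "h a * ?\<phi> u + g ^ i * (h b * ?\<phi> v) = h c * (?\<phi> u + g ^ i * ?\<phi> v)"
      "h a * ?\<phi> u + g ^ j * (h b * ?\<phi> v) = h d * (?\<phi> u + g ^ j * ?\<phi> v)"
      using *[of i] *[of j] by auto
    then obtain t where t: "t \<noteq> 0" "g ^ (j - i) = h t"
      using power_in_base_field[OF h primitive_element_nonzero[OF g] ij 4] by metis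
    \<comment> \<open>A nonzero element of the base field has (q - 1)-th power 1, so the order q^r -
      1 of \<open>g\<close> divides (j - i)(q - 1).\<close>
    have "g ^ ((j - i) * (CARD('a) - 1)) = h (t ^ (CARD('a) - 1))"
      using t(2) by (simp only: power_mult hom_power)
    then have "g ^ ((j - i) * (CARD('a) - 1)) = 1"
      using finite_field_power_card_minus_one[OF t(1)] by simp
    then have "CARD('a) ^ r - 1 dvd (j - i) * (CARD('a) - 1)"
      using primitive_element_order_dvd[OF g] card by metis
    moreover have "CARD('a) \<ge> 2" by (rule two_le_card_field)
    ultimately show thesis using repunit_dvd ndvd by simp
  qed
qed

section \<open>From the dual statement to the cutting property\<close>

theorem theorem4p1:
  fixes h :: "'a :: {field, finite} \<Rightarrow> 'b :: {field, finite}"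
    and \<gamma> :: 'b and M :: "'a mat" and q r i j :: nat
  assumes "q = CARD('a)"
    and "r \<ge> 2"
    and "CARD('b) = q ^ r"
    and "field_hom h"
    and "primitive_element \<gamma>"
    and "M = companion_mat (min_poly h \<gamma>)"
    and "0 < i" and "i < j" and "j < q ^ r"
    and "\<forall>s > 1. s dvd r \<longrightarrow> \<not> [j - i = 0] (mod ((q ^ s - 1) div (q - 1)))"
  shows "cutting_blocking_set (2 * r - 1)
           (spread_elem r M 0 \<union> spread_elem r M i \<union> spread_elem r M j \<union> spread_elem r M (q ^ r))"
proof -
  define N where "N = 2 * r - 1"
  have N: "N + 1 = r + r" using assms(2) by (simp add: N_def)
  define B where
    "B = spread_elem r M 0 \<union> spread_elem r M i \<union> spread_elem r M j \<union> spread_elem r M (q ^ r)"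
  have Mk: "M ^\<^sub>m k \<in> carrier_mat r r" for k
    using degree_min_poly_primitive_element[OF assms(4,5)] assms(1,3)
    by (intro pow_carrier_mat) (simp add: assms(6) companion_mat_def)
  \<comment> \<open>The indices 0, i, j and q^r are distinct, so each selects its intended branch of
    \<open>spread_elem\<close>.\<close>
  have "q ^ r \<noteq> 0" using assms(9) by (metis not_less_zero)
  then have B_eq: "B = {proj_pt N (x @\<^sub>v 0\<^sub>v r) | x. x \<in> carrier_vec r - {0\<^sub>v r}}
      \<union> {proj_pt N (0\<^sub>v r @\<^sub>v y) | y. y \<in> carrier_vec r - {0\<^sub>v r}}
      \<union> (\<Union>k\<in>{i, j}. {proj_pt N (x @\<^sub>v row_mult x (M ^\<^sub>m k)) | x. x \<in> carrier_vec r - {0\<^sub>v r}})"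
    using assms(1,7,8,9) unfolding B_def spread_elem_def N_def by auto
  have append: "x @\<^sub>v y \<in> carrier_vec (N + 1)"
    "x @\<^sub>v y = 0\<^sub>v (N + 1) \<longleftrightarrow> x = 0\<^sub>v r \<and> y = 0\<^sub>v r"
    if "x \<in> carrier_vec r" "y \<in> carrier_vec r" for x y :: "'a vec"
  proof -
    show "x @\<^sub>v y \<in> carrier_vec (N + 1)" using that unfolding N by simp
    have "0\<^sub>v (N + 1) = 0\<^sub>v r @\<^sub>v (0\<^sub>v r :: 'a vec)" unfolding N by (intro eq_vecI) auto
    then show "x @\<^sub>v y = 0\<^sub>v (N + 1) \<longleftrightarrow> x = 0\<^sub>v r \<and> y = 0\<^sub>v r"
      using append_vec_eq[OF that(1), of "0\<^sub>v r" y] by simp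
  qed
  have "B \<subseteq> PG N"
    unfolding B_eq using append row_mult_carrier[OF Mk] by (auto intro!: proj_pt_in_PG)
  moreover have "proj_span N (B \<inter> H) = H" if H: "hyperplane N H" for H
  proof
    obtain W where W: "VectorSpace.subspace class_ring W (module_vec TYPE('a) (N + 1))"
      "vectorspace.dim class_ring ((module_vec TYPE('a) (N + 1))\<lparr>carrier := W\<rparr>) = N"
      "H = proj_of N W"
      using H unfolding hyperplane_def by blast
    have "proj_subspace N H" using W unfolding proj_subspace_def by blast
    then show "proj_span N (B \<inter> H) \<subseteq> H" unfolding proj_span_def by blast
    obtain f where f: "f \<in> carrier_vec (N + 1)" "W = {z \<in> carrier_vec (N + 1). f \<bullet> z = 0}"
      using hyperplane_eq_kernel[OF W(1)] W(2) by (metis Suc_eq_plus1)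
    define u where "u = vec_first f r"
    define v where "v = vec_last f r"
    have uv: "u \<in> carrier_vec r" "v \<in> carrier_vec r" "f = u @\<^sub>v v"
      using f(1) unfolding N u_def v_def by auto
    have "H \<subseteq> T" if T: "proj_subspace N T" "B \<inter> H \<subseteq> T" for T
    proof -
      obtain U where U: "VectorSpace.subspace class_ring U (module_vec TYPE('a) (N + 1))"
        "T = proj_of N U"
        using T(1) unfolding proj_subspace_def by blast
      have "W \<subseteq> U"
      \<comment> \<open>If some \<open>w\<close> in the hyperplane escapes \<open>U\<close>, a form
        \<open>f'\<close> vanishes on \<open>U\<close> but not at \<open>w\<close>. The dual
        statement makes \<open>f'\<close> a multiple of \<open>f\<close>, which vanishes at
        \<open>w\<close>.\<close>
      proof (rule ccontr)
        assume "\<not> W \<subseteq> U"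
        then obtain w where w: "w \<in> W" "w \<notin> U" by blast
        have wc: "w \<in> carrier_vec (N + 1)" "f \<bullet> w = 0" using w f by auto
        obtain f' where f': "f' \<in> carrier_vec (N + 1)" "f' \<bullet> w = 1"
          "\<And>z. z \<in> U \<Longrightarrow> f' \<bullet> z = 0"
          using separating_functional[OF U(1) wc(1) w(2)] by blast
        define u' where "u' = vec_first f' r"
        define v' where "v' = vec_last f' r"
        have uv': "u' \<in> carrier_vec r" "v' \<in> carrier_vec r" "f' = u' @\<^sub>v v'"
          using f'(1) unfolding N u'_def v'_def by auto
        \<comment> \<open>A vector of the hyperplane that represents a point of \<open>B\<close>
          lies in \<open>U\<close>, where \<open>f'\<close> vanishes. The zero vector represents no
          point but lies in \<open>U\<close> as well, hence the conditional premise
          \<open>pt\<close>.\<close>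
        have main: "x \<bullet> u' + y \<bullet> v' = 0"
          if xy: "x \<in> carrier_vec r" "y \<in> carrier_vec r" "x \<bullet> u + y \<bullet> v = 0"
            and pt: "x @\<^sub>v y \<noteq> 0\<^sub>v (N + 1) \<Longrightarrow> proj_pt N (x @\<^sub>v y) \<in> B" for x y
        proof -
          have dot: "(a @\<^sub>v b) \<bullet> (x @\<^sub>v y) = x \<bullet> a + y \<bullet> b"
            if "a \<in> carrier_vec r" "b \<in> carrier_vec r" for a b
            using that xy by (simp add: scalar_prod_append comm_scalar_prod[of _ r])
          have zW: "x @\<^sub>v y \<in> W" using append xy f dot uv by simp
          have "x @\<^sub>v y \<in> U"
          proof (cases "x @\<^sub>v y = 0\<^sub>v (N + 1)")
            case True
            then show ?thesis using U(1) unfolding subspace_vec_iff by metis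
          next
            case False
            have z: "x @\<^sub>v y \<in> carrier_vec (N + 1)" using append xy by blast
            have "proj_pt N (x @\<^sub>v y) \<in> B \<inter> H"
              using pt[OF False] proj_pt_in_proj_of_iff[OF W(1) z False] zW W(3) by blast
            then show ?thesis using proj_pt_in_proj_of_iff[OF U(1) z False] T(2) U(2) by blast
          qed
          then show ?thesis using f'(3) dot[OF uv'(1,2)] uv'(3) by metis
        qed
        \<comment> \<open>This is the hypothesis on divisors taken at s = r.\<close>
        have "\<not> (CARD('a) ^ r - 1) div (CARD('a) - 1) dvd j - i"
          using assms(1,2,10) by (simp add: cong_0_iff)
        moreover have "x \<bullet> u' = 0" if x: "x \<in> carrier_vec r" "x \<bullet> u = 0" for x
        proof -
          have "x \<bullet> u' + 0\<^sub>v r \<bullet> v' = 0"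
          proof (rule main)
            assume "x @\<^sub>v 0\<^sub>v r \<noteq> 0\<^sub>v (N + 1)"
            then have "x \<noteq> 0\<^sub>v r" using append(2)[OF x(1) zero_carrier_vec] by blast
            then show "proj_pt N (x @\<^sub>v 0\<^sub>v r) \<in> B" using x(1) unfolding B_eq by blast
          qed (use x uv in auto)
          then show ?thesis using uv' by simp
        qed
        moreover have "y \<bullet> v' = 0" if y: "y \<in> carrier_vec r" "y \<bullet> v = 0" for y
        proof -
          have "0\<^sub>v r \<bullet> u' + y \<bullet> v' = 0"
          proof (rule main)
            assume "0\<^sub>v r @\<^sub>v y \<noteq> 0\<^sub>v (N + 1)"
            then have "y \<noteq> 0\<^sub>v r" using append(2)[OF zero_carrier_vec y(1)] by blast
            then show "proj_pt N (0\<^sub>v r @\<^sub>v y) \<in> B" using y(1) unfolding B_eq by blast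
          qed (use y uv in auto)
          then show ?thesis using uv' by simp
        qed
        moreover have "x \<bullet> (u' + M ^\<^sub>m k *\<^sub>v v') = 0"
          if x: "k \<in> {i, j}" "x \<in> carrier_vec r" "x \<bullet> (u + M ^\<^sub>m k *\<^sub>v v) = 0" for k x
        proof -
          \<comment> \<open>The form (a, b) evaluated at the vector (x, x M^k) of V_k.\<close>
          have dot: "x \<bullet> (a + M ^\<^sub>m k *\<^sub>v b) = x \<bullet> a + row_mult x (M ^\<^sub>m k) \<bullet> b"
            if "a \<in> carrier_vec r" "b \<in> carrier_vec r" for a b
            using that x Mk[of k]
            by (simp add: row_mult_scalar_prod[of _ r r] scalar_prod_add_distrib[of _ r])
          have "x \<bullet> u' + row_mult x (M ^\<^sub>m k) \<bullet> v' = 0"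
          proof (rule main)
            assume nz: "x @\<^sub>v row_mult x (M ^\<^sub>m k) \<noteq> 0\<^sub>v (N + 1)"
            have "row_mult (0\<^sub>v r) (M ^\<^sub>m k) = 0\<^sub>v r"
              by (rule row_mult_zero[OF Mk])
            then have "x \<noteq> 0\<^sub>v r" using nz append(2)[OF x(2) row_mult_carrier[OF Mk]] by blast
            then show "proj_pt N (x @\<^sub>v row_mult x (M ^\<^sub>m k)) \<in> B"
              using x(1,2) unfolding B_eq by blast
          qed (use x uv dot row_mult_carrier[OF Mk] in auto)
          then show ?thesis using dot uv' by simp
        qed
        ultimately obtain a where a: "u' = a \<cdot>\<^sub>v u" "v' = a \<cdot>\<^sub>v v"
          using dual_cutting[OF assms(4,5) _ assms(6) less_imp_le[OF assms(8)] _ uv(1,2) uv'(1,2)]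
            assms(1,3) by blast
        have "f' = a \<cdot>\<^sub>v f"
          unfolding uv(3) uv'(3) a using uv by (intro eq_vecI) auto
        then have "f' \<bullet> w = 0" using f(1) wc by simp
        then show False using f'(2) by simp
      qed
      then show "H \<subseteq> T" using W(3) U(2) by (auto simp: proj_of_def)
    qed
    then show "H \<subseteq> proj_span N (B \<inter> H)" unfolding proj_span_def by blast
  qed
  ultimately show ?thesis
    unfolding cutting_blocking_set_def B_def N_def by blast
qed

end
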